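(* (1) $\mathcal{V}_1\subset\mathcal{W}$, and this inclusion is proper. (2) If $(S,\cdot,{}')$ is an epigroup in $\mathcal{W}$, then for each $c\in S$, the unary variant $(S,\cdot_c,{}^{\ast})$, where $x\cdot_c y=xcy$ and $x^{\ast}=(xc)'\,x\,(cx)'$, lies in $\mathcal{V}_1$.
   Context: An element $a$ of a semigroup $S$ is an epigroup element if there is a positive integer $n$ such that $a^n$ lies in a subgroup of $S$, i.e. the $\mathcal{H}$-class $H_{a^n}$ is a group; $a$ is completely regular if this holds with $n=1$. If $e$ is the identity of $H_{a^n}$, then $ae\in H_{a^n}$ and the pseudoinverse of $a$ is $a'=(ae)^{-1}$, the inverse being taken in the group $H_{a^n}$. A semigroup is an epigroup if all its elements are epigroup elements; it is viewed as a unary semigroup $(S,\cdot,{}')$ with ${}'$ the pseudoinverse operation. $\mathcal{W}$ is the class of all semigroups $S$ such that $xy$ is completely regular for all $x,y\in S$. Every such semigroup is an epigroup, and is viewed as a unary semigroup $(S,\cdot,{}')$ with its pseudoinverse operation. $\mathcal{V}_1$ is the variety of unary semigroups (associative binary operation plus a unary operation ${}'$) satisfying the identities $x'xx'=x'$, $xx'=x'x$, $xy''=xy$ and $x''y=xy$. *)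

theory Defs
  imports "HOL-Algebra.Group"
begin

locale sgrp =
  fixes S :: "'a set" and mul :: "'a \<Rightarrow> 'a \<Rightarrow> 'a" (infixl "\<cdot>" 70)
  assumes nonempty: "S \<noteq> {}"
    and closed: "\<lbrakk>x \<in> S; y \<in> S\<rbrakk> \<Longrightarrow> x \<cdot> y \<in> S"
    and assoc: "\<lbrakk>x \<in> S; y \<in> S; z \<in> S\<rbrakk> \<Longrightarrow> (x \<cdot> y) \<cdot> z = x \<cdot> (y \<cdot> z)"
begin

text \<open>The power \<open>a\<^sup>n\<close>, meaningful for positive \<open>n\<close> only, since a semigroup need not have
  an identity (for \<open>n = 0\<close> the value is \<open>a\<close>).\<close>

definition sg_pow :: "'a \<Rightarrow> nat \<Rightarrow> 'a" where
  "sg_pow a n = ((\<lambda>x. x \<cdot> a) ^^ (n - 1)) a"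

text \<open>The principal ideals \<open>S\<^sup>1a\<close> and \<open>aS\<^sup>1\<close>; two elements are related by Green's relation
  \<open>H = L \<inter> R\<close> if they generate the same left and the same right ideal.\<close>

definition left_ideal :: "'a \<Rightarrow> 'a set" where
  "left_ideal a = insert a ((\<lambda>x. x \<cdot> a) ` S)"

definition right_ideal :: "'a \<Rightarrow> 'a set" where
  "right_ideal a = insert a ((\<lambda>x. a \<cdot> x) ` S)"

definition H_class :: "'a \<Rightarrow> 'a set" where
  "H_class a = {b \<in> S. left_ideal b = left_ideal a \<and> right_ideal b = right_ideal a}"

definition H_struct :: "'a \<Rightarrow> 'a \<Rightarrow> 'a monoid" where
  "H_struct a e = \<lparr>carrier = H_class a, mult = (\<cdot>), one = e\<rparr>"

text \<open>An element lies in some subgroup of the semigroup exactly if its \<open>H\<close>-class is itself a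
  group (Green's theorem); the latter form is used, as it also yields the pseudoinverse.\<close>

definition H_class_is_group :: "'a \<Rightarrow> bool" where
  "H_class_is_group a \<longleftrightarrow> (\<exists>e. group (H_struct a e))"

definition epigroup_element :: "'a \<Rightarrow> bool" where
  "epigroup_element a \<longleftrightarrow> a \<in> S \<and> (\<exists>n>0. H_class_is_group (sg_pow a n))"

definition completely_regular :: "'a \<Rightarrow> bool" where
  "completely_regular a \<longleftrightarrow> a \<in> S \<and> H_class_is_group (sg_pow a 1)"

text \<open>A relation rather than a function: the exponent \<open>n\<close> is not unique, although the resulting
  \<open>b\<close> does not depend on it.\<close>

definition is_pseudoinverse :: "'a \<Rightarrow> 'a \<Rightarrow> bool" where
  "is_pseudoinverse a b \<longleftrightarrow> a \<in> S \<and>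
     (\<exists>n>0. \<exists>e. group (H_struct (sg_pow a n) e) \<and> b = inv\<^bsub>H_struct (sg_pow a n) e\<^esub> (a \<cdot> e))"

end

locale epigroup = sgrp +
  assumes epi: "a \<in> S \<Longrightarrow> epigroup_element a"

locale unary_epigroup = epigroup +
  fixes pinv :: "'a \<Rightarrow> 'a"
  assumes pseudoinverse: "a \<in> S \<Longrightarrow> is_pseudoinverse a (pinv a)"

locale class_W = sgrp +
  assumes products_cr: "\<lbrakk>x \<in> S; y \<in> S\<rbrakk> \<Longrightarrow> completely_regular (x \<cdot> y)"

text \<open>The members of \<open>class_W\<close> viewed as unary semigroups.\<close>

locale unary_W = class_W S mul + unary_epigroup S mul pinv
  for S :: "'a set" and mul :: "'a \<Rightarrow> 'a \<Rightarrow> 'a" (infixl "\<cdot>" 70) and pinv :: "'a \<Rightarrow> 'a"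

locale unary_sgrp = sgrp +
  fixes u :: "'a \<Rightarrow> 'a"
  assumes u_closed: "x \<in> S \<Longrightarrow> u x \<in> S"

locale variety_V1 = unary_sgrp +
  assumes V1_a: "x \<in> S \<Longrightarrow> u x \<cdot> x \<cdot> u x = u x"
    and V1_b: "x \<in> S \<Longrightarrow> x \<cdot> u x = u x \<cdot> x"
    and V1_c: "\<lbrakk>x \<in> S; y \<in> S\<rbrakk> \<Longrightarrow> x \<cdot> u (u y) = x \<cdot> y"
    and V1_d: "\<lbrakk>x \<in> S; y \<in> S\<rbrakk> \<Longrightarrow> u (u x) \<cdot> y = x \<cdot> y"

definition variant_mul :: "('a \<Rightarrow> 'a \<Rightarrow> 'a) \<Rightarrow> 'a \<Rightarrow> 'a \<Rightarrow> 'a \<Rightarrow> 'a" where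
  "variant_mul mul c x y = mul (mul x c) y"

definition variant_inv :: "('a \<Rightarrow> 'a \<Rightarrow> 'a) \<Rightarrow> ('a \<Rightarrow> 'a) \<Rightarrow> 'a \<Rightarrow> 'a \<Rightarrow> 'a" where
  "variant_inv mul pinv c x = mul (mul (pinv (mul x c)) x) (pinv (mul c x))"

end

(*
  An element a has a group H-class exactly if it has a group inverse, i.e. a commuting b with
  aba = a and bab = b, and b is a pseudoinverse of a exactly if ab = ba, bab = b and a^n ab = a^n
  for some n > 0. In V_1 one has x'' = xx'x, so x^2 xx' = x^2, and (xy)'' = xy because yy' is a
  right identity for xy; hence x' is the pseudoinverse of x and (xy)' a group inverse of xy.
  For the variants, (xc)'x = x(cx)' rewrites x* as (xc)'(xc)'x and as x(cx)'(cx)', so that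
  x*c = (xc)', cx* = (cx)' and x** = (xc)x*(cx).
*)
theory Submission
  imports Defs
begin

context sgrp
begin

section \<open>Group inverses and powers\<close>

definition group_inverse :: "'a \<Rightarrow> 'a \<Rightarrow> bool" where
  "group_inverse a b \<longleftrightarrow> a \<in> S \<and> b \<in> S \<and> a \<cdot> b = b \<cdot> a \<and> a \<cdot> b \<cdot> a = a \<and> b \<cdot> a \<cdot> b = b"

lemma group_inverseD:
  assumes "group_inverse a b"
  shows "a \<in> S" "b \<in> S" "a \<cdot> b = b \<cdot> a" "a \<cdot> b \<cdot> a = a" "b \<cdot> a \<cdot> b = b"
  using assms unfolding group_inverse_def by blast+

lemma group_inverse_sym: "group_inverse a b \<Longrightarrow> group_inverse b a"
  by (auto simp: group_inverse_def)

text \<open>The idempotents ab and ac coincide: ac ab = ab because aca = a, while ca ba = ca because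
  aba = a. Then b = bac = abc = acc = cac = c.\<close>

lemma group_inverse_unique:
  assumes "group_inverse a b" and "group_inverse a c"
  shows "b = c"
proof -
  have S: "a \<in> S" "b \<in> S" "c \<in> S"
    and b: "a \<cdot> b = b \<cdot> a" "a \<cdot> b \<cdot> a = a" "b \<cdot> a \<cdot> b = b"
    and c: "a \<cdot> c = c \<cdot> a" "a \<cdot> c \<cdot> a = a" "c \<cdot> a \<cdot> c = c"
    using assms by (auto simp: group_inverse_def)
  have e: "a \<cdot> b = a \<cdot> c"
    using S b c by (metis assoc closed)
  have "b = b \<cdot> (a \<cdot> c)" using S b e by (simp add: assoc)
  also have "\<dots> = c \<cdot> a \<cdot> c" using S b c e by (metis assoc)
  finally show ?thesis using c by simp
qed

lemma sg_pow_1: "sg_pow a (Suc 0) = a"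
  by (simp add: sg_pow_def)

lemma sg_pow_Suc: "n > 0 \<Longrightarrow> sg_pow a (Suc n) = sg_pow a n \<cdot> a"
  by (cases n) (simp_all add: sg_pow_def)

lemma sg_pow_closed: "n > 0 \<Longrightarrow> a \<in> S \<Longrightarrow> sg_pow a n \<in> S"
  by (induction n rule: nat_induct_non_zero) (simp_all add: sg_pow_1 sg_pow_Suc closed)

lemma sg_pow_commute:
  "n > 0 \<Longrightarrow> a \<in> S \<Longrightarrow> a \<cdot> sg_pow a n = sg_pow a n \<cdot> a"
  by (induction n rule: nat_induct_non_zero)
    (simp_all add: sg_pow_1 sg_pow_Suc sg_pow_closed assoc[symmetric])

section \<open>Group H-classes and group inverses\<close>

lemma left_ideal_subset:
  "\<lbrakk>s \<in> S; y \<in> S; x = s \<cdot> y\<rbrakk> \<Longrightarrow> left_ideal x \<subseteq> left_ideal y"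
  by (auto simp: left_ideal_def assoc[symmetric] closed)

lemma right_ideal_subset:
  "\<lbrakk>s \<in> S; y \<in> S; x = y \<cdot> s\<rbrakk> \<Longrightarrow> right_ideal x \<subseteq> right_ideal y"
  by (auto simp: right_ideal_def assoc closed)

text \<open>The idempotent gh acts as identity on \<open>k\<close>, and \<open>l\<close>,
  \<open>r\<close> are one-sided inverses of \<open>k\<close> relative to it. Hence \<open>g\<close>
  and \<open>k\<close> are left and right multiples of each other.\<close>

lemma H_classI:
  assumes "group_inverse g h" and S: "k \<in> S" "l \<in> S" "r \<in> S"
    and "k \<cdot> (g \<cdot> h) = k" "(g \<cdot> h) \<cdot> k = k" "l \<cdot> k = g \<cdot> h" "k \<cdot> r = g \<cdot> h"
  shows "k \<in> H_class g"
proof -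
  have g: "g \<in> S" "h \<in> S" "g \<cdot> h = h \<cdot> g" "g \<cdot> h \<cdot> g = g"
    using assms(1) by (auto simp: group_inverse_def)
  have "k = (k \<cdot> h) \<cdot> g" "g = (g \<cdot> l) \<cdot> k" "k = g \<cdot> (h \<cdot> k)" "g = k \<cdot> (r \<cdot> g)"
    using assms g by (metis assoc)+
  then show ?thesis
    using S g left_ideal_subset right_ideal_subset closed
    unfolding H_class_def by (simp add: set_eq_subset) metis
qed

text \<open>Converse of \<open>H_classI\<close>, with a two-sided inverse that again lies in the
  H-class. It supplies identity and inverses of the group structure.\<close>

lemma H_classE:
  assumes "group_inverse g h" and k: "k \<in> H_class g"
  obtains l where "l \<in> H_class g" "l \<cdot> k = g \<cdot> h" "k \<cdot> l = g \<cdot> h"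
    "k \<in> S" "k \<cdot> (g \<cdot> h) = k" "(g \<cdot> h) \<cdot> k = k"
proof -
  have g: "g \<in> S" "h \<in> S" "g \<cdot> h = h \<cdot> g" "g \<cdot> h \<cdot> g = g"
    using assms(1) by (auto simp: group_inverse_def)
  have ggh: "g \<cdot> (g \<cdot> h) = g" using g by (metis assoc)
  have kS: "k \<in> S" and "k \<in> left_ideal g" "g \<in> left_ideal k" "k \<in> right_ideal g" "g \<in> right_ideal k"
    using k by (auto simp: H_class_def left_ideal_def right_ideal_def)
  have ke: "k \<cdot> (g \<cdot> h) = k"
    using \<open>k \<in> left_ideal g\<close> g(1,2) ggh by (auto simp: left_ideal_def assoc closed)
  have ek: "(g \<cdot> h) \<cdot> k = k"
    using \<open>k \<in> right_ideal g\<close> g by (auto simp: right_ideal_def assoc[symmetric] closed)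
  \<comment> \<open>Either g = k or g = sk with \<open>s\<close> in \<open>S\<close>; multiplying by
    \<open>h\<close> on the left gives a multiplier in \<open>S\<close> in both cases.\<close>
  have "\<exists>l\<in>S. l \<cdot> k = h \<cdot> g"
    using \<open>g \<in> left_ideal k\<close> g(1,2) kS closed by (auto simp: left_ideal_def assoc[symmetric])
  then obtain l where l: "l \<in> S" "l \<cdot> k = g \<cdot> h" unfolding g(3) by blast
  have "\<exists>r\<in>S. k \<cdot> r = g \<cdot> h"
    using \<open>g \<in> right_ideal k\<close> g(1,2) kS closed by (auto simp: right_ideal_def assoc)
  then obtain r where r: "r \<in> S" "k \<cdot> r = g \<cdot> h" by blast
  \<comment> \<open>The one-sided inverses \<open>l\<close> and \<open>r\<close> need not absorb gh.
    The product lkr equals both (gh)r and l(gh), so it is a two-sided inverse that does.\<close>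
  define i where "i = l \<cdot> k \<cdot> r"
  have iS: "i \<in> S" using l(1) r(1) kS by (simp add: i_def closed)
  have i: "i \<cdot> k = g \<cdot> h" "k \<cdot> i = g \<cdot> h"
    using l r kS g ke ek by (metis assoc closed i_def)+
  have "i \<cdot> (g \<cdot> h) = i" "(g \<cdot> h) \<cdot> i = i"
    using l r kS g ke ek i iS by (metis assoc closed i_def)+
  then have "i \<in> H_class g"
    using H_classI[OF assms(1) iS kS kS] i by simp
  then show ?thesis using that i ke ek kS by blast
qed

text \<open>By \<open>H_classE\<close> every element of the H-class has an inverse relative to the
  idempotent gh; \<open>H_classI\<close> then gives closure under products.\<close>

lemma group_H_structI:
  assumes gh: "group_inverse g h"
  shows "group (H_struct g (g \<cdot> h))"
proof (rule groupI)
  have g: "g \<in> S" "h \<in> S" "g \<cdot> h = h \<cdot> g" "g \<cdot> h \<cdot> g = g" "h \<cdot> g \<cdot> h = h"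
    using gh by (auto simp: group_inverse_def)
  have e: "g \<cdot> h \<cdot> (g \<cdot> h) = g \<cdot> h"
    using g(1,2,4) by (simp add: closed flip: assoc)
  show "\<one>\<^bsub>H_struct g (g \<cdot> h)\<^esub> \<in> carrier (H_struct g (g \<cdot> h))"
    using H_classI[OF gh, of "g \<cdot> h" "g \<cdot> h" "g \<cdot> h"] g(1,2) e closed by (simp add: H_struct_def)
  fix x assume "x \<in> carrier (H_struct g (g \<cdot> h))"
  then have "x \<in> H_class g" by (simp add: H_struct_def)
  then obtain i where i: "i \<in> H_class g" "i \<cdot> x = g \<cdot> h" "x \<cdot> i = g \<cdot> h" "x \<in> S"
      "x \<cdot> (g \<cdot> h) = x" "(g \<cdot> h) \<cdot> x = x"
    by (rule H_classE[OF gh])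
  then have iS: "i \<in> S" by (simp add: H_class_def)
  show "\<one>\<^bsub>H_struct g (g \<cdot> h)\<^esub> \<otimes>\<^bsub>H_struct g (g \<cdot> h)\<^esub> x = x"
    using i by (simp add: H_struct_def)
  show "\<exists>y\<in>carrier (H_struct g (g \<cdot> h)).
      y \<otimes>\<^bsub>H_struct g (g \<cdot> h)\<^esub> x = \<one>\<^bsub>H_struct g (g \<cdot> h)\<^esub>"
    using i by (auto simp: H_struct_def)
  fix y assume "y \<in> carrier (H_struct g (g \<cdot> h))"
  then have "y \<in> H_class g" by (simp add: H_struct_def)
  then obtain j where j: "j \<in> H_class g" "j \<cdot> y = g \<cdot> h" "y \<cdot> j = g \<cdot> h" "y \<in> S"
      "y \<cdot> (g \<cdot> h) = y" "(g \<cdot> h) \<cdot> y = y"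
    by (rule H_classE[OF gh])
  then have jS: "j \<in> S" by (simp add: H_class_def)
  have "x \<cdot> y \<cdot> (g \<cdot> h) = x \<cdot> y" "(g \<cdot> h) \<cdot> (x \<cdot> y) = x \<cdot> y"
    using i j g(1,2) by (metis assoc closed)+
  \<comment> \<open>As in any group, the inverse of xy is ji, the inverses taken in reverse
    order.\<close>
  moreover have "(j \<cdot> i) \<cdot> (x \<cdot> y) = g \<cdot> h"
    using i j iS jS g(1,2) by (metis assoc closed)
  moreover have "(x \<cdot> y) \<cdot> (j \<cdot> i) = g \<cdot> h"
    using i j iS jS g(1,2) by (metis assoc closed)
  ultimately show "x \<otimes>\<^bsub>H_struct g (g \<cdot> h)\<^esub> y \<in> carrier (H_struct g (g \<cdot> h))"
    using H_classI[OF gh, of "x \<cdot> y" "j \<cdot> i" "j \<cdot> i"] i(4) j(4) iS jS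
    by (simp add: H_struct_def closed)
  fix z assume "z \<in> carrier (H_struct g (g \<cdot> h))"
  then have "z \<in> S" by (simp add: H_struct_def H_class_def)
  then show "x \<otimes>\<^bsub>H_struct g (g \<cdot> h)\<^esub> y \<otimes>\<^bsub>H_struct g (g \<cdot> h)\<^esub> z =
      x \<otimes>\<^bsub>H_struct g (g \<cdot> h)\<^esub> (y \<otimes>\<^bsub>H_struct g (g \<cdot> h)\<^esub> z)"
    using i j by (simp add: H_struct_def assoc)
qed

text \<open>Take for \<open>h\<close> the inverse of \<open>g\<close> in the given group; the group
  laws then hold in the semigroup itself.\<close>

lemma group_H_structD:
  assumes gS: "g \<in> S" and "group (H_struct g e)"
  obtains h where "group_inverse g h" "e = g \<cdot> h"
proof -
  interpret H: group "H_struct g e" by fact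
  have g: "g \<in> carrier (H_struct g e)" using gS by (simp add: H_struct_def H_class_def)
  define h where "h = inv\<^bsub>H_struct g e\<^esub> g"
  have h: "h \<in> carrier (H_struct g e)" using g by (simp add: h_def)
  then have hS: "h \<in> S" by (simp add: H_struct_def H_class_def)
  have gh: "g \<cdot> h = e" "h \<cdot> g = e"
    using H.r_inv[OF g] H.l_inv[OF g] by (simp_all add: H_struct_def h_def)
  have "e \<cdot> g = g" "e \<cdot> h = h"
    using H.l_one[OF g] H.l_one[OF h] by (simp_all add: H_struct_def)
  then show ?thesis
    using that[of h] gS hS unfolding group_inverse_def gh by simp
qed

lemma completely_regular_iff: "completely_regular a \<longleftrightarrow> (\<exists>b. group_inverse a b)"
proof
  assume "completely_regular a"
  then show "\<exists>b. group_inverse a b"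
    unfolding completely_regular_def H_class_is_group_def
    by (auto simp: sg_pow_1 elim: group_H_structD)
next
  assume "\<exists>b. group_inverse a b"
  then obtain b where b: "group_inverse a b" ..
  then have "a \<in> S" by (simp add: group_inverse_def)
  then show "completely_regular a"
    using group_H_structI[OF b]
    unfolding completely_regular_def H_class_is_group_def by (auto simp: sg_pow_1)
qed

section \<open>Equational description of the pseudoinverse\<close>

text \<open>The identity \<open>e\<close> of the H-class of a^n commutes with \<open>a\<close>, and
  ae lies in that class. Its inverse \<open>b\<close> there satisfies ab = ba = e, which gives all
  the equations.\<close>

lemma is_pseudoinverseD:
  assumes "is_pseudoinverse a b"
  obtains n where "a \<in> S" "b \<in> S" "a \<cdot> b = b \<cdot> a" "b \<cdot> a \<cdot> b = b"
    "n > 0" "sg_pow a n \<cdot> (a \<cdot> b) = sg_pow a n"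
proof -
  obtain n e where aS: "a \<in> S" and n: "n > 0" and G: "group (H_struct (sg_pow a n) e)"
    and b_def: "b = inv\<^bsub>H_struct (sg_pow a n) e\<^esub> (a \<cdot> e)"
    using assms by (auto simp: is_pseudoinverse_def)
  define g where "g = sg_pow a n"
  have gS: "g \<in> S" using aS n by (simp add: g_def sg_pow_closed)
  obtain h where gh: "group_inverse g h" and e: "e = g \<cdot> h"
    using group_H_structD[OF gS] G by (auto simp: g_def)
  have hS: "h \<in> S" and eq: "g \<cdot> h = h \<cdot> g" "e \<cdot> g = g" "g \<cdot> e = g" and eS: "e \<in> S"
    using gh gS unfolding e group_inverse_def by (auto simp: closed) (metis assoc)
  have "e \<cdot> e = e \<cdot> g \<cdot> h" using hS gS eS by (simp add: e assoc closed)
  then have ee: "e \<cdot> e = e" using eq(2) e by simp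
  have ag: "a \<cdot> g = g \<cdot> a" using sg_pow_commute aS n by (simp add: g_def)
  \<comment> \<open>As \<open>a\<close> commutes with \<open>g\<close>, ae = agh = gah absorbs
    \<open>e\<close> on the left; dually ea = hga = hag absorbs \<open>e\<close> on the
    right.\<close>
  have "e \<cdot> a \<cdot> e = a \<cdot> e"
    using eq hS gS aS ag e eS by (metis assoc closed)
  moreover have "e \<cdot> a \<cdot> e = e \<cdot> a"
    using eq hS gS aS ag e eS by (metis assoc closed)
  ultimately have ae: "a \<cdot> e = e \<cdot> a" by simp
  have "a \<cdot> e \<in> H_class g"
  \<comment> \<open>Since \<open>sg_pow a 0\<close> has the default value \<open>a\<close>,
    splitting off a factor \<open>a\<close> from \<open>g\<close> requires n > 1.\<close>
  proof (cases "n = 1")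
    case True
    then have "g = a" by (simp add: g_def sg_pow_1)
    then show ?thesis using eq gS by (simp add: H_class_def)
  next
    case False
    define p where "p = sg_pow a (n - 1)"
    have pS: "p \<in> S" using False n aS by (simp add: p_def sg_pow_closed)
    have pa: "p \<cdot> a = g"
      using False n sg_pow_Suc[of "n - 1" a] by (simp add: p_def g_def)
    have ap: "a \<cdot> p = g"
      using False n sg_pow_commute[of "n - 1" a] aS pa by (simp add: p_def)
    \<comment> \<open>Both products collapse through pa = ap = g, so hp and ph are one-sided
      inverses of ae relative to \<open>e\<close>.\<close>
    have "(h \<cdot> p) \<cdot> (a \<cdot> e) = e"
      using pS pa hS gS aS eS eq e ee by (metis assoc closed)
    moreover have "(a \<cdot> e) \<cdot> (p \<cdot> h) = e"
      using pS ap hS gS aS eS eq e ae by (metis assoc closed)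
    moreover have "(a \<cdot> e) \<cdot> e = a \<cdot> e" "e \<cdot> (a \<cdot> e) = a \<cdot> e"
      using ee ae aS eS by (metis assoc)+
    ultimately show ?thesis
      using H_classI[OF gh, of "a \<cdot> e" "h \<cdot> p" "p \<cdot> h"] pS hS aS eS e closed by simp
  qed
  then have aeH: "a \<cdot> e \<in> carrier (H_struct g e)" by (simp add: H_struct_def)
  interpret H: group "H_struct g e" using G by (simp add: g_def)
  have b: "b = inv\<^bsub>H_struct g e\<^esub> (a \<cdot> e)" by (simp add: b_def g_def)
  have bH: "b \<in> carrier (H_struct g e)" using aeH b by simp
  then have bS: "b \<in> S" by (simp add: H_struct_def H_class_def)
  have "(a \<cdot> e) \<cdot> b = e" "b \<cdot> (a \<cdot> e) = e" "e \<cdot> b = b" "b \<cdot> e = b"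
    using H.r_inv[OF aeH] H.l_inv[OF aeH] H.l_one[OF bH] H.r_one[OF bH]
    by (simp_all add: b H_struct_def)
  then have ab: "a \<cdot> b = e" and ba: "b \<cdot> a = e" and "e \<cdot> b = b"
    using aS bS eS ae by (metis assoc)+
  then show ?thesis using that[OF aS bS _ _ n] eq(3) by (simp add: g_def)
qed

text \<open>All powers of \<open>a\<close> and \<open>b\<close> multiply to the idempotent ab. For
  the exponent \<open>n\<close> at which a^n absorbs ab, this makes b^n essentially a group inverse
  of a^n, and \<open>b\<close> inverts ae in the resulting group.\<close>

lemma is_pseudoinverseI:
  assumes aS: "a \<in> S" and bS: "b \<in> S" and ab: "a \<cdot> b = b \<cdot> a" and bab: "b \<cdot> a \<cdot> b = b"
    and n: "n > 0" and an: "sg_pow a n \<cdot> (a \<cdot> b) = sg_pow a n"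
  shows "is_pseudoinverse a b"
proof -
  define e where "e = a \<cdot> b"
  have eS: "e \<in> S" using aS bS by (simp add: e_def closed)
  have e: "e \<cdot> b = b" "b \<cdot> e = b" "e \<cdot> a = a \<cdot> e" "e \<cdot> e = e" "b \<cdot> a = e"
    using aS bS ab bab by (metis assoc closed e_def)+
  have powers: "sg_pow a m \<cdot> sg_pow b m = e \<and> sg_pow b m \<cdot> sg_pow a m = e" if "m > 0" for m
    using that
  proof (induction m rule: nat_induct_non_zero)
    case 1
    then show ?case using ab by (simp add: sg_pow_1 e_def)
  next
    case (Suc m)
    define p q where "p = sg_pow a m" and "q = sg_pow b m"
    have pq: "p \<in> S" "q \<in> S" "p \<cdot> q = e" "q \<cdot> p = e" "b \<cdot> q = q \<cdot> b" "a \<cdot> p = p \<cdot> a"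
      using Suc aS bS by (auto simp: p_def q_def sg_pow_closed sg_pow_commute)
    \<comment> \<open>The inner product pq is \<open>e\<close> by induction, and aeb = ab =
      e.\<close>
    have "(p \<cdot> a) \<cdot> (q \<cdot> b) = a \<cdot> (p \<cdot> q) \<cdot> b"
      using pq(1,2,6) aS bS by (metis assoc closed)
    also have "\<dots> = e" using pq(3) e aS bS eS by (simp add: assoc) (simp add: e_def)
    finally have "(p \<cdot> a) \<cdot> (q \<cdot> b) = e" .
    moreover have "(q \<cdot> b) \<cdot> (p \<cdot> a) = b \<cdot> (q \<cdot> p) \<cdot> a"
      using pq(1,2,5) aS bS by (metis assoc closed)
    then have "(q \<cdot> b) \<cdot> (p \<cdot> a) = e"
      using pq(4) e aS bS eS by simp
    ultimately show ?case using Suc by (simp add: sg_pow_Suc p_def q_def)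
  qed
  \<comment> \<open>The factor \<open>e\<close> in \<open>h\<close> makes \<open>h\<close> absorb
    \<open>e\<close> on the left directly, by idempotence.\<close>
  define g h where "g = sg_pow a n" and "h = e \<cdot> sg_pow b n"
  have S: "g \<in> S" "h \<in> S" "sg_pow b n \<in> S"
    using aS bS n eS by (simp_all add: g_def h_def sg_pow_closed closed)
  have ge: "g \<cdot> e = g" using an by (simp add: g_def e_def)
  have gh: "g \<cdot> h = e"
    using ge powers[OF n] S eS by (metis assoc g_def h_def)
  have hg: "h \<cdot> g = e"
    using e powers[OF n] S eS by (metis assoc g_def h_def)
  have "e \<cdot> h = h" using e S eS by (metis assoc h_def)
  moreover have "e \<cdot> g = g" using ge gh hg S by (metis assoc)
  ultimately have gi: "group_inverse g h"
    using S gh hg by (simp add: group_inverse_def)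
  have G: "group (H_struct g e)" using group_H_structI[OF gi] gh by simp
  interpret H: group "H_struct g e" by (fact G)
  have "a \<cdot> e \<cdot> e = a \<cdot> e" "e \<cdot> (a \<cdot> e) = a \<cdot> e" "b \<cdot> (a \<cdot> e) = e" "a \<cdot> e \<cdot> b = e"
    using e aS bS eS by (metis assoc e_def)+
  \<comment> \<open>The elements ae and \<open>b\<close> are mutually inverse relative to
    \<open>e\<close>, so each serves as the witness for the other.\<close>
  then have "a \<cdot> e \<in> H_class g" and "b \<in> H_class g"
    using H_classI[OF gi, of "a \<cdot> e" b b] H_classI[OF gi, of b "a \<cdot> e" "a \<cdot> e"]
      e aS bS eS gh closed by simp_all
  then have "inv\<^bsub>H_struct g e\<^esub> (a \<cdot> e) = b"
    using \<open>b \<cdot> (a \<cdot> e) = e\<close> by (intro H.inv_equality) (simp_all add: H_struct_def)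
  then show ?thesis
    using aS n G unfolding is_pseudoinverse_def g_def by metis
qed

text \<open>A group inverse \<open>h\<close> of \<open>a\<close> cancels factors in a^n ab = a^n
  until the exponent is 1. The resulting equation aab = a is the one missing from
  \<open>is_pseudoinverseD\<close>.\<close>

lemma is_pseudoinverse_completely_regular:
  assumes "is_pseudoinverse a b" and "completely_regular a"
  shows "group_inverse a b"
proof -
  obtain n where S: "a \<in> S" "b \<in> S" and b: "a \<cdot> b = b \<cdot> a" "b \<cdot> a \<cdot> b = b"
    and n: "n > 0" and an: "sg_pow a n \<cdot> (a \<cdot> b) = sg_pow a n"
    using is_pseudoinverseD[OF assms(1)] .
  obtain h where h: "h \<in> S" "a \<cdot> h = h \<cdot> a" "a \<cdot> h \<cdot> a = a"
    using assms(2) by (auto simp: completely_regular_iff group_inverse_def)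
  have "a \<cdot> (a \<cdot> b) = a"
    using n an
  proof (induction n rule: nat_induct_non_zero)
    case 1
    then show ?case by (simp add: sg_pow_1)
  next
    case (Suc m)
    define p where "p = sg_pow a m"
    have p: "p \<in> S" "a \<cdot> p = p \<cdot> a"
      using Suc S by (auto simp: p_def sg_pow_closed sg_pow_commute)
    \<comment> \<open>Multiplication by \<open>h\<close> lowers the exponent by one, since haa = a.
      The case m = 1 is separate because \<open>sg_pow a 0\<close> is no empty power.\<close>
    have "h \<cdot> (p \<cdot> a) = p"
      using \<open>m > 0\<close> unfolding p_def
    proof (cases "m = 1")
      case True
      then show "h \<cdot> (sg_pow a m \<cdot> a) = sg_pow a m"
        using h S by (metis One_nat_def assoc sg_pow_1)
    next
      case False
      define r where "r = sg_pow a (m - 1)"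
      have r: "r \<in> S" "a \<cdot> r = r \<cdot> a" "sg_pow a m = r \<cdot> a"
        using False Suc S sg_pow_Suc[of "m - 1" a]
        by (auto simp: r_def sg_pow_closed sg_pow_commute)
      then show "h \<cdot> (sg_pow a m \<cdot> a) = sg_pow a m"
        using h S by (metis assoc closed)
    qed
    moreover have "p \<cdot> a \<cdot> (a \<cdot> b) = p \<cdot> a"
      using Suc by (simp add: p_def sg_pow_Suc)
    ultimately have "p \<cdot> (a \<cdot> b) = p"
      using p(1) h(1) S by (metis assoc closed)
    then show ?case using Suc by (simp add: p_def)
  qed
  then have "a \<cdot> b \<cdot> a = a" using S b(1) by (metis assoc)
  then show ?thesis using S b by (simp add: group_inverse_def)
qed

end

section \<open>Members of V_1 belong to W\<close>

text \<open>The identity \<open>V1_d\<close> equates p'' and p only after a further factor on the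
  right. The factor y'y is harmless, being a right identity for both.\<close>

lemma (in variety_V1) double_prime_prod:
  assumes "x \<in> S" and "y \<in> S"
  shows "u (u (x \<cdot> y)) = x \<cdot> y"
proof -
  define p where "p = x \<cdot> y"
  have S: "p \<in> S" "u p \<in> S" "u (u p) \<in> S" "u y \<in> S" "u (u y) \<in> S"
    using assms by (simp_all add: p_def closed u_closed)
  \<comment> \<open>In p'' = p''p'p'', from \<open>V1_a\<close> at p', the outer factors are
    replaced by p through \<open>V1_c\<close> and \<open>V1_d\<close>.\<close>
  have pp: "u (u p) = p \<cdot> u p \<cdot> p"
    using V1_a[of "u p"] V1_c[of _ p] V1_d[of p] S by (metis closed)
  have yy: "u (u y) = y \<cdot> u y \<cdot> y"
    using V1_a[of "u y"] V1_c[of _ y] V1_d[of y] S assms by (metis closed)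
  have py: "p \<cdot> (u y \<cdot> y) = p"
  proof -
    have "p = x \<cdot> u (u y)" using V1_c assms by (simp add: p_def)
    then show ?thesis using yy S assms by (metis assoc closed p_def)
  qed
  have "u (u p) = u (u p) \<cdot> (u y \<cdot> y)"
    using pp py S assms by (metis assoc closed)
  also have "\<dots> = p"
    using V1_d[of p "u y \<cdot> y"] S assms py by (simp add: closed)
  finally show ?thesis by (simp add: p_def)
qed

lemma (in variety_V1) unary_W: "unary_W S (\<cdot>) u"
proof -
  have ps: "is_pseudoinverse x (u x)" if x: "x \<in> S" for x
  \<comment> \<open>The exponent is 2 because \<open>V1_c\<close> removes the double prime from x''
    = xx'x only behind another factor, here x itself.\<close>
  proof (rule is_pseudoinverseI[where n = 2])
    have uS: "u x \<in> S" "u (u x) \<in> S" using x by (simp_all add: u_closed)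
    have "u (u x) = x \<cdot> u x \<cdot> x"
      using V1_a[of "u x"] V1_c[of _ x] V1_d[of x] uS x by (metis closed)
    then have "x \<cdot> (x \<cdot> u x \<cdot> x) = x \<cdot> x" using V1_c[of x x] x by simp
    then have "x \<cdot> x \<cdot> (x \<cdot> u x) = x \<cdot> x"
      using V1_b[of x] x uS by (metis assoc closed)
    then show "sg_pow x 2 \<cdot> (x \<cdot> u x) = sg_pow x 2"
      using sg_pow_Suc[of 1 x] by (simp add: sg_pow_1 numeral_2_eq_2)
  qed (use x in \<open>simp_all add: u_closed V1_a V1_b\<close>)
  show ?thesis
  proof unfold_locales
    fix x y assume "x \<in> S" "y \<in> S"
    then have S: "x \<cdot> y \<in> S" "u (x \<cdot> y) \<in> S" by (simp_all add: closed u_closed)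
    \<comment> \<open>As (xy)'' = xy, \<open>V1_a\<close> at (xy)' yields the remaining equation of
      a group inverse.\<close>
    have "group_inverse (x \<cdot> y) (u (x \<cdot> y))"
      using V1_a[of "x \<cdot> y"] V1_a[of "u (x \<cdot> y)"] V1_b[of "x \<cdot> y"] S
        double_prime_prod[OF \<open>x \<in> S\<close> \<open>y \<in> S\<close>]
      by (simp add: group_inverse_def)
    then show "completely_regular (x \<cdot> y)" by (auto simp: completely_regular_iff)
  next
    fix a assume "a \<in> S"
    then show "epigroup_element a"
      using ps[of a]
      by (auto simp: is_pseudoinverse_def epigroup_element_def H_class_is_group_def)
  qed (fact ps)
qed

section \<open>A member of W outside V_1\<close>

text \<open>The constant maps of \<open>{0, 1, 2}\<close> together with \<open>3\<close>, which stands for the map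
  \<open>0 \<mapsto> 1 \<mapsto> 2 \<mapsto> 2\<close>, composed from left to right. The pseudoinverse of \<open>3\<close> is its square \<open>2\<close>.\<close>

definition ex_mul :: "nat \<Rightarrow> nat \<Rightarrow> nat" where
  "ex_mul s t = (if t < 3 then t else if s = 0 then 1 else 2)"

definition ex_inv :: "nat \<Rightarrow> nat" where
  "ex_inv t = (if t < 3 then t else 2)"

text \<open>Every product is one of the constant maps 0, 1, 2. These are idempotent, hence their own
  group inverses.\<close>

lemma ex_unary_W: "unary_W {0..3} ex_mul ex_inv"
proof -
  interpret sgrp "{0..3::nat}" ex_mul
    by unfold_locales (auto simp: ex_mul_def)
  have ps: "is_pseudoinverse a (ex_inv a)" if "a \<in> {0..3}" for a
    using that
    by (intro is_pseudoinverseI[where n = 2])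
      (auto simp: ex_mul_def ex_inv_def sg_pow_def numeral_2_eq_2)
  show ?thesis
  proof unfold_locales
    fix x y :: nat assume "x \<in> {0..3}" "y \<in> {0..3}"
    then have "group_inverse (ex_mul x y) (ex_mul x y)"
      by (auto simp: group_inverse_def ex_mul_def)
    then show "completely_regular (ex_mul x y)" by (auto simp: completely_regular_iff)
  next
    fix a :: nat assume "a \<in> {0..3}"
    then show "epigroup_element a"
      using ps[of a]
      by (auto simp: is_pseudoinverse_def epigroup_element_def H_class_is_group_def)
  qed (fact ps)
qed

lemma ex_not_V1: "\<not> variety_V1 {0..3} ex_mul ex_inv"
proof
  assume "variety_V1 {0..3} ex_mul ex_inv"
  then interpret variety_V1 "{0..3::nat}" ex_mul ex_inv .
  \<comment> \<open>Here 03 = 1, whereas 3'' = 2 and 02 = 2.\<close>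
  show False using V1_c[of 0 3] by (simp add: ex_mul_def ex_inv_def)
qed

section \<open>Variants of members of W\<close>

context unary_W
begin

lemma pinv_prod:
  assumes "x \<in> S" and "y \<in> S"
  shows "group_inverse (x \<cdot> y) (pinv (x \<cdot> y))"
  using is_pseudoinverse_completely_regular[OF pseudoinverse products_cr] assms by (simp add: closed)

text \<open>The group inverse of xy is itself completely regular, with group inverse xy by symmetry;
  uniqueness identifies this with its pseudoinverse.\<close>

lemma pinv_pinv_prod:
  assumes "x \<in> S" and "y \<in> S"
  shows "pinv (pinv (x \<cdot> y)) = x \<cdot> y"
proof -
  have gi: "group_inverse (x \<cdot> y) (pinv (x \<cdot> y))" using pinv_prod assms .
  then have "pinv (x \<cdot> y) \<in> S" and "completely_regular (pinv (x \<cdot> y))"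
    using group_inverse_sym by (auto simp: completely_regular_iff) (simp add: group_inverse_def)
  then have "group_inverse (pinv (x \<cdot> y)) (pinv (pinv (x \<cdot> y)))"
    using is_pseudoinverse_completely_regular pseudoinverse by blast
  then show ?thesis using gi group_inverse_sym group_inverse_unique by blast
qed

lemma variant_V1:
  assumes c: "c \<in> S"
  shows "variety_V1 S (variant_mul (\<cdot>) c) (variant_inv (\<cdot>) pinv c)"
proof -
  define st where "st = variant_inv (\<cdot>) pinv c"
  have pS: "pinv (x \<cdot> y) \<in> S" if "x \<in> S" "y \<in> S" for x y
    using pinv_prod[OF that] by (simp add: group_inverse_def)
  have stS: "st x \<in> S" if "x \<in> S" for x
    using that c by (simp add: st_def variant_inv_def closed pS)
  \<comment> \<open>With \<open>p\<close> and \<open>q\<close> the pseudoinverses of xc and cx, both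
    sides equal px(cx)q. Writing p = pp(xc) produces a factor cx on which \<open>q\<close> acts, and
    q = (cx)qq produces a factor xc for \<open>p\<close>.\<close>
  have swap: "pinv (x \<cdot> c) \<cdot> x = x \<cdot> pinv (c \<cdot> x)" if x: "x \<in> S" for x
  proof -
    define p q where "p = pinv (x \<cdot> c)" and "q = pinv (c \<cdot> x)"
    have p: "p \<in> S" "(x \<cdot> c) \<cdot> p = p \<cdot> (x \<cdot> c)" "(x \<cdot> c) \<cdot> p \<cdot> (x \<cdot> c) = x \<cdot> c" "p \<cdot> (x \<cdot> c) \<cdot> p = p"
      unfolding p_def by (fact group_inverseD[OF pinv_prod[OF x c]])+
    have q: "q \<in> S" "(c \<cdot> x) \<cdot> q = q \<cdot> (c \<cdot> x)" "(c \<cdot> x) \<cdot> q \<cdot> (c \<cdot> x) = c \<cdot> x" "q \<cdot> (c \<cdot> x) \<cdot> q = q"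
      unfolding q_def by (fact group_inverseD[OF pinv_prod[OF c x]])+
    have "p \<cdot> x = p \<cdot> p \<cdot> (x \<cdot> c) \<cdot> x" using p x c by (metis assoc closed)
    also have "\<dots> = p \<cdot> p \<cdot> x \<cdot> (c \<cdot> x)" using p(1) x c by (simp add: assoc closed)
    also have "\<dots> = p \<cdot> p \<cdot> x \<cdot> ((c \<cdot> x) \<cdot> (c \<cdot> x) \<cdot> q)" using q x c by (metis assoc closed)
    also have "\<dots> = (p \<cdot> p \<cdot> (x \<cdot> c)) \<cdot> (x \<cdot> (c \<cdot> x) \<cdot> q)"
      using p(1) q(1) x c by (simp add: assoc closed)
    also have "\<dots> = p \<cdot> (x \<cdot> (c \<cdot> x) \<cdot> q)" using p x c by (metis assoc closed)
    finally have 1: "p \<cdot> x = p \<cdot> (x \<cdot> (c \<cdot> x) \<cdot> q)" .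
    have "x \<cdot> q = (x \<cdot> c) \<cdot> x \<cdot> q \<cdot> q" using q x c by (metis assoc closed)
    also have "\<dots> = (p \<cdot> (x \<cdot> c) \<cdot> (x \<cdot> c)) \<cdot> x \<cdot> q \<cdot> q" using p by simp
    also have "\<dots> = p \<cdot> (x \<cdot> c) \<cdot> x \<cdot> ((c \<cdot> x) \<cdot> q \<cdot> q)"
      using p(1) q(1) x c by (simp add: assoc closed)
    also have "\<dots> = p \<cdot> (x \<cdot> c) \<cdot> x \<cdot> q" using q by simp
    also have "\<dots> = p \<cdot> (x \<cdot> (c \<cdot> x) \<cdot> q)" using p(1) q(1) x c by (simp add: assoc closed)
    finally show ?thesis using 1 by (simp add: p_def q_def)
  qed
  have st_left: "st x = pinv (x \<cdot> c) \<cdot> pinv (x \<cdot> c) \<cdot> x" if "x \<in> S" for x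
    using swap[OF that, symmetric] that c by (simp add: st_def variant_inv_def assoc pS)
  have st_right: "st x = x \<cdot> pinv (c \<cdot> x) \<cdot> pinv (c \<cdot> x)" if "x \<in> S" for x
    using swap[OF that] that c by (simp add: st_def variant_inv_def)
  have st_c: "st x \<cdot> c = pinv (x \<cdot> c)" if x: "x \<in> S" for x
  proof -
    note p = group_inverseD[OF pinv_prod[OF x c]]
    have "st x \<cdot> c = pinv (x \<cdot> c) \<cdot> (pinv (x \<cdot> c) \<cdot> (x \<cdot> c))"
      using st_left[OF x] p(2) x c by (simp add: assoc closed)
    also have "\<dots> = pinv (x \<cdot> c) \<cdot> ((x \<cdot> c) \<cdot> pinv (x \<cdot> c))" by (simp only: p(3))
    also have "\<dots> = pinv (x \<cdot> c)" using p(1,2,5) by (simp flip: assoc)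
    finally show ?thesis .
  qed
  have c_st: "c \<cdot> st x = pinv (c \<cdot> x)" if x: "x \<in> S" for x
  proof -
    note q = group_inverseD[OF pinv_prod[OF c x]]
    have "c \<cdot> st x = (c \<cdot> x) \<cdot> pinv (c \<cdot> x) \<cdot> pinv (c \<cdot> x)"
      using st_right[OF x] q(2) x c by (simp add: assoc closed)
    then show ?thesis by (simp only: q(3,5))
  qed
  \<comment> \<open>By \<open>st_c\<close> and \<open>c_st\<close> the outer factors are
    pseudoinverses of pseudoinverses of xc and cx, and \<open>pinv_pinv_prod\<close> removes
    both.\<close>
  have st_st: "st (st x) = (x \<cdot> c) \<cdot> st x \<cdot> (c \<cdot> x)" if x: "x \<in> S" for x
  proof -
    have "st (st x) = pinv (st x \<cdot> c) \<cdot> st x \<cdot> pinv (c \<cdot> st x)"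
      unfolding st_def by (simp add: variant_inv_def)
    then show ?thesis using x c by (simp add: st_c c_st pinv_pinv_prod)
  qed
  have "variety_V1 S (variant_mul (\<cdot>) c) st"
  proof unfold_locales
    fix x assume x: "x \<in> S"
    show "st x \<in> S" using stS x .
    define p where "p = pinv (x \<cdot> c)"
    have p: "p \<in> S" "(x \<cdot> c) \<cdot> p = p \<cdot> (x \<cdot> c)" "p \<cdot> (x \<cdot> c) \<cdot> p = p"
      unfolding p_def by (fact group_inverseD[OF pinv_prod[OF x c]])+
    show "variant_mul (\<cdot>) c (variant_mul (\<cdot>) c (st x) x) (st x) = st x"
    proof -
      \<comment> \<open>The last \<open>st x\<close> is expanded as ppx, so that p(xc)p reduces to
        \<open>p\<close> and ppx remains.\<close>
      have "st x \<cdot> c \<cdot> x \<cdot> c \<cdot> st x = p \<cdot> (x \<cdot> c) \<cdot> p \<cdot> p \<cdot> x"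
        using st_c[OF x] st_left[OF x] p(1) x c by (simp add: p_def assoc closed)
      then show ?thesis using p(3) st_left[OF x] by (simp add: variant_mul_def p_def)
    qed
    show "variant_mul (\<cdot>) c x (st x) = variant_mul (\<cdot>) c (st x) x"
    proof -
      \<comment> \<open>Commuting \<open>p\<close> with xc turns (xc)ppx into px, which is also the
        value of the other side.\<close>
      have "x \<cdot> c \<cdot> st x = (x \<cdot> c) \<cdot> p \<cdot> p \<cdot> x"
        using st_left[OF x] p(1) x c by (simp add: p_def assoc closed)
      then show ?thesis using p(2,3) st_c[OF x] by (simp add: variant_mul_def p_def)
    qed
    fix y assume y: "y \<in> S"
    show "variant_mul (\<cdot>) c x (st (st y)) = variant_mul (\<cdot>) c x y"
    proof -
      \<comment> \<open>Multiplied by \<open>c\<close> on the left, \<open>st (st y)\<close> becomes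
        (cy)(cy)'(cy) = cy. The last identity is dual, with xc and multiplication on the
        right.\<close>
      have "x \<cdot> c \<cdot> st (st y) = x \<cdot> ((c \<cdot> y) \<cdot> pinv (c \<cdot> y) \<cdot> (c \<cdot> y))"
        using st_st[OF y] c_st[OF y] stS[OF y] x y c pS[OF c y] by (metis assoc closed)
      then show ?thesis
        unfolding variant_mul_def group_inverseD(4)[OF pinv_prod[OF c y]]
        using x y c by (simp add: assoc)
    qed
    show "variant_mul (\<cdot>) c (st (st x)) y = variant_mul (\<cdot>) c x y"
    proof -
      have "st (st x) \<cdot> c = (x \<cdot> c) \<cdot> pinv (x \<cdot> c) \<cdot> (x \<cdot> c)"
        using st_st[OF x] st_c[OF x] stS[OF x] x c pS[OF x c] by (metis assoc closed)
      then show ?thesis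
        unfolding variant_mul_def group_inverseD(4)[OF pinv_prod[OF x c]] by simp
    qed
  qed (use c nonempty in \<open>auto simp: variant_mul_def closed assoc\<close>)
  then show ?thesis by (simp add: st_def)
qed

end

theorem theorem10:
  shows "(\<forall>(S :: 'a set) mul u. variety_V1 S mul u \<longrightarrow> unary_W S mul u)
       \<and> (\<exists>(S :: nat set) mul u. unary_W S mul u \<and> \<not> variety_V1 S mul u)
       \<and> (\<forall>(S :: 'a set) mul pinv. unary_W S mul pinv \<longrightarrow>
            (\<forall>c\<in>S. variety_V1 S (variant_mul mul c) (variant_inv mul pinv c)))"
proof (intro conjI allI impI ballI)
  show "unary_W S mul u" if "variety_V1 S mul u" for S :: "'a set" and mul u
    using that by (rule variety_V1.unary_W)
  show "\<exists>(S :: nat set) mul u. unary_W S mul u \<and> \<not> variety_V1 S mul u"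
    using ex_unary_W ex_not_V1 by (intro exI conjI)
  show "variety_V1 S (variant_mul mul c) (variant_inv mul pinv c)"
    if "unary_W S mul pinv" and "c \<in> S" for S :: "'a set" and mul pinv c
    using that by (rule unary_W.variant_V1)
qed

end
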